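(* Let $S$ be a Hausdorff pseudocompact topological semigroup which is algebraically a primitive inverse semigroup, $S=\sum_{i\in\mathscr I}B_{\lambda_i}(G_i)$. Then: (i) every cardinal $\lambda_i$ is finite; (ii) every non-zero maximal subgroup of $S$ is an open-and-closed subset of $S$ and hence is pseudocompact; (iii) for every $i\in\mathscr I$ the subspace $B_{\lambda_i}(G_i)$ is pseudocompact and each maximal subgroup $(G_i)_{\alpha,\alpha}$ is a pseudocompact paratopological group; (iv) if $\mathscr B$ is a base of the topology at the unit $(\alpha_i,e_i,\alpha_i)$ of $(G_i)_{\alpha_i,\alpha_i}$ with $U\subseteq (G_i)_{\alpha_i,\alpha_i}$ for all $U\in\mathscr B$, then for all $\beta_i,\gamma_i\in\lambda_i$ and $x\in G_i$ the family $\{(\beta_i,x,\alpha_i)\cdot U\cdot(\alpha_i,e_i,\gamma_i):U\in\mathscr B\}$ is a base of the topology at $(\beta_i,x,\gamma_i)$; (v) if moreover $S$ is semiregular, then the family of all sets $S\setminus\big((G_{i_1})_{\alpha_1,\beta_1}\cup\dots\cup(G_{i_k})_{\alpha_k,\beta_k}\big)$, where $k\in\mathbb N$, $i_1,\dots,i_k\in\mathscr I$, $\alpha_j,\beta_j\in\lambda_{i_j}$, is a base of the topology of $S$ at zero.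
   Context: A topological semigroup is a Hausdorff space with jointly continuous associative operation; a paratopological group is a group with Hausdorff topology and jointly continuous multiplication. Pseudocompact: every locally finite family of non-empty open sets is finite; semiregular: having a base of regular open sets. For a group $G$ and cardinal $\lambda\ge1$, $B_\lambda(G)=(\lambda\times G\times\lambda)\cup\{0\}$ with $(\alpha,a,\beta)(\gamma,b,\delta)=(\alpha,ab,\delta)$ if $\beta=\gamma$ and $0$ otherwise. The orthogonal sum of semigroups $T_\iota$ with zeros is $\{0\}\cup\bigcup_\iota(T_\iota\setminus\{0_\iota\})$ with products computed in $T_\iota$ when both factors lie in the same $T_\iota$ and the product is non-zero, and $0$ otherwise. Primitive inverse semigroups are exactly orthogonal sums $\sum_{i\in\mathscr I}B_{\lambda_i}(G_i)$; we identify $B_{\lambda_i}(G_i)$ with a subsemigroup of $S$, write $(G_i)_{\alpha,\beta}=\{(\alpha,g,\beta):g\in G_i\}$, $e_i$ for the unit of $G_i$; maximal subgroups of $S$ are $\{0\}$ and the $(G_i)_{\alpha,\alpha}$, with subspace topology. *)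

theory Defs
  imports "HOL-Analysis.Analysis" "HOL-Algebra.Group"
begin

definition pseudocompact_space :: "'a topology \<Rightarrow> bool" where
  "pseudocompact_space X \<longleftrightarrow>
     (\<forall>\<U>. (\<forall>U\<in>\<U>. openin X U \<and> U \<noteq> {}) \<and> locally_finite_in X \<U> \<longrightarrow> finite \<U>)"

definition regular_openin :: "'a topology \<Rightarrow> 'a set \<Rightarrow> bool" where
  "regular_openin X U \<longleftrightarrow> X interior_of (X closure_of U) = U"

definition semiregular_space :: "'a topology \<Rightarrow> bool" where
  "semiregular_space X \<longleftrightarrow>
     (\<forall>W x. openin X W \<and> x \<in> W \<longrightarrow> (\<exists>U. regular_openin X U \<and> x \<in> U \<and> U \<subseteq> W))"

definition nhds_base_at :: "'a topology \<Rightarrow> 'a \<Rightarrow> 'a set set \<Rightarrow> bool" where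
  "nhds_base_at X x \<B> \<longleftrightarrow>
     (\<forall>U\<in>\<B>. openin X U \<and> x \<in> U) \<and>
     (\<forall>W. openin X W \<and> x \<in> W \<longrightarrow> (\<exists>U\<in>\<B>. U \<subseteq> W))"

definition topological_semigroup :: "'a topology \<Rightarrow> ('a \<Rightarrow> 'a \<Rightarrow> 'a) \<Rightarrow> bool" where
  "topological_semigroup X f \<longleftrightarrow>
     Hausdorff_space X \<and>
     (\<forall>x\<in>topspace X. \<forall>y\<in>topspace X. f x y \<in> topspace X) \<and>
     (\<forall>x\<in>topspace X. \<forall>y\<in>topspace X. \<forall>z\<in>topspace X. f (f x y) z = f x (f y z)) \<and>
     continuous_map (prod_topology X X) X (\<lambda>(x, y). f x y)"

definition paratopological_group :: "'a topology \<Rightarrow> 'a monoid \<Rightarrow> bool" where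
  "paratopological_group X M \<longleftrightarrow>
     group M \<and> topspace X = carrier M \<and> Hausdorff_space X \<and>
     continuous_map (prod_topology X X) X (\<lambda>(x, y). x \<otimes>\<^bsub>M\<^esub> y)"

text \<open>Elements: None is the zero; Some (i, a, g, b) is the element (a, g, b) of B_{lambda_i}(G_i).\<close>
type_synonym ('i, 'l, 'g) pelt = "('i \<times> 'l \<times> 'g \<times> 'l) option"

definition prim_carrier :: "'i set \<Rightarrow> ('i \<Rightarrow> 'l set) \<Rightarrow> ('i \<Rightarrow> 'g monoid) \<Rightarrow> ('i, 'l, 'g) pelt set" where
  "prim_carrier I L G = insert None
     {Some (i, a, g, b) | i a g b. i \<in> I \<and> a \<in> L i \<and> b \<in> L i \<and> g \<in> carrier (G i)}"

definition prim_mult :: "('i \<Rightarrow> 'g monoid) \<Rightarrow> ('i, 'l, 'g) pelt \<Rightarrow> ('i, 'l, 'g) pelt \<Rightarrow> ('i, 'l, 'g) pelt" where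
  "prim_mult G x y = (case (x, y) of
      (Some (i, a, g, b), Some (j, c, h, d)) \<Rightarrow>
         if i = j \<and> b = c then Some (i, a, g \<otimes>\<^bsub>G i\<^esub> h, d) else None
    | _ \<Rightarrow> None)"

definition brandt_part :: "('i \<Rightarrow> 'l set) \<Rightarrow> ('i \<Rightarrow> 'g monoid) \<Rightarrow> 'i \<Rightarrow> ('i, 'l, 'g) pelt set" where
  "brandt_part L G i = insert None
     {Some (i, a, g, b) | a g b. a \<in> L i \<and> b \<in> L i \<and> g \<in> carrier (G i)}"

definition cell :: "('i \<Rightarrow> 'g monoid) \<Rightarrow> 'i \<Rightarrow> 'l \<Rightarrow> 'l \<Rightarrow> ('i, 'l, 'g) pelt set" where
  "cell G i a b = {Some (i, a, g, b) | g. g \<in> carrier (G i)}"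

definition max_subgroup :: "('i \<Rightarrow> 'g monoid) \<Rightarrow> 'i \<Rightarrow> 'l \<Rightarrow> ('i, 'l, 'g) pelt monoid" where
  "max_subgroup G i a = \<lparr>carrier = cell G i a a, mult = prim_mult G, one = Some (i, a, \<one>\<^bsub>G i\<^esub>, a)\<rparr>"

end

(*
  The crucial point is that zero is not adherent to a maximal subgroup G. Inversion in G need not
  be continuous a priori, but pseudocompactness makes it continuous up to closures; if elements h_n
  of G came close to zero, translates by their inverses of a small neighbourhood of the unit would
  have no cluster point. Once the sets (G_i)_{a,b} are open and closed, zero is the only possible
  cluster point of a family of open sets taken from distinct ones, and the rest follows by choosing
  such families that avoid a neighbourhood of zero.
*)
theory Submission
  imports Defs
begin

text \<open>A cell together with zero is closed for a formal reason: multiplication by idempotents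
  on both sides is a continuous retraction onto it. Continuity alone does not separate the cell from
  zero, as the non-negative reals under multiplication show: there elements tend to zero while their
  inverses run off to infinity. Pseudocompactness forbids running off, but it yields cluster points
  of open sets only, so the inverses have to be thickened by a neighbourhood \<open>V\<close> of the
  unit, and undoing the thickening requires inverses of elements of \<open>V\<close>. Knowing these
  up to closure is enough, since an open set disjoint from another set also misses its closure.
  Semiregularity matters at zero for a similar reason: a neighbourhood of zero is merely forced to
  be dense in all but finitely many cells and could omit a nowhere dense part of each of them;
  regular open sets have no such gaps.\<close>

section \<open>Pseudocompact spaces\<close>

text \<open>Cluster points count indices, whereas pseudocompactness counts sets. The two agree
  because a sequence with finite range repeats one set infinitely often, and any point of that set
  will do.\<close>

lemma pseudocompact_cluster_point:
  fixes Q :: "nat \<Rightarrow> 'a set"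
  assumes pc: "pseudocompact_space X"
    and opn: "\<And>n. openin X (Q n)" and ne: "\<And>n. Q n \<noteq> {}"
  shows "\<exists>x\<in>topspace X. \<forall>U. openin X U \<and> x \<in> U \<longrightarrow> infinite {n. Q n \<inter> U \<noteq> {}}"
proof (rule ccontr)
  assume neg: "\<not> ?thesis"
  have "locally_finite_in X (range Q)"
    unfolding locally_finite_in_def
  proof (intro conjI ballI)
    show "\<Union>(range Q) \<subseteq> topspace X"
      using opn openin_subset by blast
  next
    fix x assume "x \<in> topspace X"
    then obtain U where U: "openin X U" "x \<in> U" "finite {n. Q n \<inter> U \<noteq> {}}"
      using neg by blast
    have "{A \<in> range Q. A \<inter> U \<noteq> {}} = Q ` {n. Q n \<inter> U \<noteq> {}}"
      by auto
    with U show "\<exists>V. openin X V \<and> x \<in> V \<and> finite {A \<in> range Q. A \<inter> V \<noteq> {}}"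
      by auto
  qed
  moreover have "\<forall>A\<in>range Q. openin X A \<and> A \<noteq> {}" using opn ne by simp
  ultimately have "finite (range Q)"
    using pc unfolding pseudocompact_space_def by metis
  then obtain k where k: "infinite {n. Q n = Q k}"
    using pigeonhole_infinite[of "UNIV :: nat set" Q] by auto
  obtain x where x: "x \<in> Q k" using ne by blast
  then obtain U where "x \<in> U" "finite {n. Q n \<inter> U \<noteq> {}}"
    using neg opn[of k] openin_subset by blast
  moreover have "{n. Q n = Q k} \<subseteq> {n. Q n \<inter> U \<noteq> {}}"
    using x \<open>x \<in> U\<close> by auto
  ultimately show False
    using k finite_subset by blast
qed

text \<open>Members of the family that avoid \<open>p\<close> are open in \<open>X\<close>; those
  that contain \<open>p\<close> are finitely many by local finiteness at \<open>p\<close>. The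
  exceptional point is meant for the zero in \<open>brandt_part\<close>, which need not be open at
  zero.\<close>

lemma pseudocompact_subspace:
  assumes pc: "pseudocompact_space X" and cl: "closedin X A" and opn: "openin X (A - {p})"
  shows "pseudocompact_space (subtopology X A)"
  unfolding pseudocompact_space_def
proof (intro allI impI)
  fix \<U>
  assume asm: "(\<forall>U\<in>\<U>. openin (subtopology X A) U \<and> U \<noteq> {}) \<and>
    locally_finite_in (subtopology X A) \<U>"
  then have lf: "locally_finite_in (subtopology X A) \<U>" by blast
  have AX: "A \<subseteq> topspace X" using cl closedin_subset by blast
  let ?V = "{U \<in> \<U>. p \<notin> U}"
  have opV: "openin X U" if "U \<in> ?V" for U
  proof -
    have "openin (subtopology X A) U" using asm that by blast
    then obtain T where T: "openin X T" "U = T \<inter> A"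
      by (auto simp: openin_subtopology)
    then have "U = T \<inter> (A - {p})" using that by auto
    with T opn show ?thesis by (metis openin_Int)
  qed
  have "locally_finite_in X ?V"
    unfolding locally_finite_in_def
  proof (intro conjI ballI)
    show "\<Union>?V \<subseteq> topspace X" using opV openin_subset by blast
  next
    fix x assume x: "x \<in> topspace X"
    show "\<exists>V. openin X V \<and> x \<in> V \<and> finite {U \<in> ?V. U \<inter> V \<noteq> {}}"
    proof (cases "x \<in> A")
      case True
      with x have "x \<in> topspace (subtopology X A)" by simp
      then obtain V where V: "openin (subtopology X A) V" "x \<in> V" "finite {U \<in> \<U>. U \<inter> V \<noteq> {}}"
        using lf unfolding locally_finite_in_def by blast
      then obtain T where T: "openin X T" "V = T \<inter> A" by (auto simp: openin_subtopology)
      have "U \<subseteq> A" if "U \<in> \<U>" for U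
        using asm that by (auto simp: openin_subtopology)
      then have "{U \<in> ?V. U \<inter> T \<noteq> {}} \<subseteq> {U \<in> \<U>. U \<inter> V \<noteq> {}}"
        using T by blast
      then show ?thesis using T V finite_subset by blast
    next
      case False
      have "U \<subseteq> A" if "U \<in> \<U>" for U
        using asm that by (auto simp: openin_subtopology)
      then have "{U \<in> ?V. U \<inter> (topspace X - A) \<noteq> {}} = {}" by blast
      then have "finite {U \<in> ?V. U \<inter> (topspace X - A) \<noteq> {}}" by (simp only: finite.emptyI)
      moreover have "openin X (topspace X - A)" using cl by blast
      ultimately show ?thesis using False x by blast
    qed
  qed
  then have fin: "finite ?V"
    using pc opV asm unfolding pseudocompact_space_def by blast
  have "finite {U \<in> \<U>. p \<in> U}"
  proof (cases "p \<in> A")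
    case True
    with AX have "p \<in> topspace (subtopology X A)" by auto
    then obtain V where V: "p \<in> V" "finite {U \<in> \<U>. U \<inter> V \<noteq> {}}"
      using lf unfolding locally_finite_in_def by blast
    then show ?thesis by (elim rev_finite_subset) auto
  next
    case False
    then have "{U \<in> \<U>. p \<in> U} = {}"
      using asm by (auto simp: openin_subtopology)
    then show ?thesis by (simp only: finite.emptyI)
  qed
  moreover have "\<U> = ?V \<union> {U \<in> \<U>. p \<in> U}" by blast
  ultimately show "finite \<U>" using fin by (metis finite_Un)
qed

section \<open>Jointly continuous multiplications\<close>

locale continuous_mult =
  fixes X :: "'a topology" and f :: "'a \<Rightarrow> 'a \<Rightarrow> 'a"
  assumes Hausdorff: "Hausdorff_space X"
    and continuous_mult: "continuous_map (prod_topology X X) X (\<lambda>(x, y). f x y)"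
begin

lemma mult_in_topspace: "x \<in> topspace X \<Longrightarrow> y \<in> topspace X \<Longrightarrow> f x y \<in> topspace X"
  using continuous_map_image_subset_topspace[OF continuous_mult] by auto

lemma mult_nhds:
  assumes "openin X W" "f x y \<in> W" "x \<in> topspace X" "y \<in> topspace X"
  obtains U V where "openin X U" "x \<in> U" "openin X V" "y \<in> V"
    "\<And>u v. u \<in> U \<Longrightarrow> v \<in> V \<Longrightarrow> f u v \<in> W"
proof -
  have "openin (prod_topology X X) {p \<in> topspace (prod_topology X X). (\<lambda>(x, y). f x y) p \<in> W}"
    using continuous_mult assms(1) by (rule openin_continuous_map_preimage)
  moreover have "(x, y) \<in> {p \<in> topspace (prod_topology X X). (\<lambda>(x, y). f x y) p \<in> W}"
    using assms by simp
  ultimately have "\<exists>U V. openin X U \<and> openin X V \<and> x \<in> U \<and> y \<in> V \<and>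
      U \<times> V \<subseteq> {p \<in> topspace (prod_topology X X). (\<lambda>(x, y). f x y) p \<in> W}"
    unfolding openin_prod_topology_alt by simp
  then obtain U V where UV: "openin X U" "openin X V" "x \<in> U" "y \<in> V"
    "U \<times> V \<subseteq> {p \<in> topspace (prod_topology X X). (\<lambda>(x, y). f x y) p \<in> W}"
    by (elim exE conjE)
  show ?thesis
    by (rule that[of U V]) (use UV in auto)
qed

lemma continuous_left_mult:
  assumes "a \<in> topspace X"
  shows "continuous_map X X (f a)"
proof -
  have "continuous_map X (prod_topology X X) (\<lambda>x. (a, x))"
    using assms by (simp add: continuous_map_pairedI)
  from continuous_map_compose[OF this continuous_mult] show ?thesis
    by (simp add: o_def)
qed

lemma continuous_right_mult:
  assumes "a \<in> topspace X"
  shows "continuous_map X X (\<lambda>x. f x a)"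
proof -
  have "continuous_map X (prod_topology X X) (\<lambda>x. (x, a))"
    using assms by (simp add: continuous_map_pairedI)
  from continuous_map_compose[OF this continuous_mult] show ?thesis
    by (simp add: o_def)
qed

text \<open>Inverses of small elements will be known only up to closure; this allows products to be
  formed with them.\<close>

lemma closure_of_mult:
  assumes "a \<in> X closure_of A" "b \<in> X closure_of B"
    and "\<And>x y. x \<in> A \<Longrightarrow> y \<in> B \<Longrightarrow> f x y \<in> C"
  shows "f a b \<in> X closure_of C"
  unfolding in_closure_of
proof (intro conjI allI impI)
  have ab: "a \<in> topspace X" "b \<in> topspace X"
    using assms by (auto simp: in_closure_of)
  then show "f a b \<in> topspace X" by (rule mult_in_topspace)
  fix T assume T: "f a b \<in> T \<and> openin X T"
  then obtain U V where UV: "openin X U" "a \<in> U" "openin X V" "b \<in> V"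
    "\<And>u v. u \<in> U \<Longrightarrow> v \<in> V \<Longrightarrow> f u v \<in> T"
    using mult_nhds ab by metis
  then obtain x y where "x \<in> A" "x \<in> U" "y \<in> B" "y \<in> V"
    using assms(1,2) unfolding in_closure_of by metis
  with UV assms(3) show "\<exists>y. y \<in> C \<and> y \<in> T" by blast
qed

end

section \<open>Groups inside a pseudocompact space with zero\<close>

text \<open>\<open>X\<close> is the topology of the ambient semigroup and \<open>mult M\<close> is
  its multiplication on all of \<open>X\<close>, so that products with \<open>z\<close> make sense.
  By \<open>closed_carrier_zero\<close>, zero is the only point outside the group that can be
  adherent to it.\<close>

locale zero_extended_group = group M + continuous_mult X "mult M"
  for M :: "'a monoid" (structure) and X :: "'a topology" +
  fixes z :: 'a
  assumes pseudocompact: "pseudocompact_space X"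
    and open_carrier: "openin X (carrier M)"
    and closed_carrier_zero: "closedin X (insert z (carrier M))"
    and zero_notin: "z \<notin> carrier M"
    and zero_left: "x \<in> insert z (carrier M) \<Longrightarrow> z \<otimes> x = z"
begin

lemma carrier_topspace: "x \<in> carrier M \<Longrightarrow> x \<in> topspace X"
  using open_carrier openin_subset by blast

lemma zero_topspace: "z \<in> topspace X"
  using closed_carrier_zero closedin_subset by blast

text \<open>The translate is a preimage under multiplication by \<open>inv g\<close>, so no
  continuity of inversion enters. Intersecting with the carrier discards points outside the group
  that this multiplication might send into \<open>U\<close>.\<close>

lemma open_translate:
  assumes U: "openin X U" "U \<subseteq> carrier M" and g: "g \<in> carrier M"
  shows "openin X ((\<lambda>u. g \<otimes> u) ` U)"
proof -
  have "openin X {y \<in> topspace X. inv g \<otimes> y \<in> U}"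
    using continuous_left_mult[of "inv g"] U(1) g carrier_topspace
    by (intro openin_continuous_map_preimage) auto
  then have "openin X (carrier M \<inter> {y \<in> topspace X. inv g \<otimes> y \<in> U})"
    using open_carrier by blast
  moreover have "carrier M \<inter> {y \<in> topspace X. inv g \<otimes> y \<in> U} = (\<lambda>u. g \<otimes> u) ` U" (is "?A = ?B")
  proof
    show "?A \<subseteq> ?B"
    proof
      fix y assume y: "y \<in> ?A"
      then have "y = g \<otimes> (inv g \<otimes> y)" using g by (simp add: m_assoc[symmetric])
      then show "y \<in> ?B" using y by blast
    qed
    show "?B \<subseteq> ?A"
      using U(2) g carrier_topspace by (auto simp: m_assoc[symmetric] subset_iff)
  qed
  ultimately show ?thesis by simp
qed

lemma square_root_nhd:
  assumes "openin X W" "\<one> \<in> W"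
  obtains V where "openin X V" "\<one> \<in> V" "V \<subseteq> W" "V \<subseteq> carrier M"
    "\<And>x y. x \<in> V \<Longrightarrow> y \<in> V \<Longrightarrow> x \<otimes> y \<in> W"
proof -
  obtain A B where AB: "openin X A" "\<one> \<in> A" "openin X B" "\<one> \<in> B"
    "\<And>u v. u \<in> A \<Longrightarrow> v \<in> B \<Longrightarrow> u \<otimes> v \<in> W"
    using mult_nhds[of W \<one> \<one>] assms carrier_topspace by auto
  show ?thesis
    by (rule that[of "A \<inter> B \<inter> W \<inter> carrier M"]) (use AB assms open_carrier in auto)
qed

lemma one_zero_separation:
  obtains U Z where "openin X U" "\<one> \<in> U" "openin X Z" "z \<in> Z" "U \<inter> Z = {}" "U \<subseteq> carrier M"
proof -
  have "\<one> \<noteq> z" using zero_notin one_closed by blast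
  then obtain U Z where "openin X U" "openin X Z" "\<one> \<in> U" "z \<in> Z" "disjnt U Z"
    using Hausdorff carrier_topspace[OF one_closed] zero_topspace
    unfolding Hausdorff_space_def by blast
  then show ?thesis
    using that[of "U \<inter> carrier M" Z] open_carrier by (auto simp: disjnt_def)
qed

text \<open>Assuming the contrary, choose \<open>x\<^sub>n \<in> V\<^sub>n\<^sub>+\<^sub>1\<close> whose inverse is not in the closure of \<open>U\<close>,
  where \<open>V\<^sub>n\<^sub>+\<^sub>1 V\<^sub>n\<^sub>+\<^sub>1 \<subseteq> V\<^sub>n\<close>, and a neighbourhood \<open>P\<^sub>n \<subseteq> V\<^sub>n\<^sub>+\<^sub>1\<close> of the unit missing \<open>x\<^sub>n U\<close>.
  With \<open>p\<^sub>n = x\<^sub>0 \<dots> x\<^sub>n\<^sub>-\<^sub>1\<close> the sets \<open>p\<^sub>n V\<^sub>n\<close> decrease, so a cluster point \<open>q\<close> of the sets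
  \<open>p\<^sub>n P\<^sub>n \<subseteq> p\<^sub>n V\<^sub>n\<close> lies in the closure of every one of them, while \<open>p\<^sub>n P\<^sub>n\<close> misses
  \<open>p\<^sub>n\<^sub>+\<^sub>1 U\<close>, whose closure contains \<open>q W\<close>.\<close>

lemma inverse_nhd:
  assumes U: "openin X U" "\<one> \<in> U" "U \<subseteq> carrier M"
  shows "\<exists>V. openin X V \<and> \<one> \<in> V \<and> V \<subseteq> U \<and> (\<forall>v\<in>V. inv v \<in> X closure_of U)"
proof (rule ccontr)
  assume "\<not> ?thesis"
  then have neg: "\<exists>v\<in>V. inv v \<notin> X closure_of U"
    if "openin X V" "\<one> \<in> V" "V \<subseteq> U" for V
    using that by blast
  obtain N Z where NZ: "openin X N" "\<one> \<in> N" "openin X Z" "z \<in> Z" "N \<inter> Z = {}" "N \<subseteq> carrier M"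
    by (rule one_zero_separation)
  \<comment> \<open>The factor \<open>U\<close> serves the product \<open>v \<otimes> w\<close> at
    the very end; the factor \<open>N\<close> keeps \<open>D 0\<close> away from zero, so that the
    cluster point is an element of the group.\<close>
  obtain W where W: "openin X W" "\<one> \<in> W" "W \<subseteq> U \<inter> N" "W \<subseteq> carrier M"
    "\<And>x y. x \<in> W \<Longrightarrow> y \<in> W \<Longrightarrow> x \<otimes> y \<in> U \<inter> N"
    using square_root_nhd[of "U \<inter> N"] U NZ by auto
  have "\<exists>V. \<forall>n. (openin X (V n) \<and> \<one> \<in> V n \<and> V n \<subseteq> W) \<and>
      (\<forall>x\<in>V (Suc n). \<forall>y\<in>V (Suc n). x \<otimes> y \<in> V n)"
  proof (rule dependent_nat_choice)
    show "\<exists>V. openin X V \<and> \<one> \<in> V \<and> V \<subseteq> W" using W by blast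
  next
    fix V and n :: nat
    assume "openin X V \<and> \<one> \<in> V \<and> V \<subseteq> W"
    then show "\<exists>V'. (openin X V' \<and> \<one> \<in> V' \<and> V' \<subseteq> W) \<and> (\<forall>x\<in>V'. \<forall>y\<in>V'. x \<otimes> y \<in> V)"
      using square_root_nhd[of V] by (metis subset_trans)
  qed
  then obtain V where V: "\<And>n. openin X (V n)" "\<And>n. \<one> \<in> V n" "\<And>n. V n \<subseteq> W"
    and VV: "\<And>n x y. x \<in> V (Suc n) \<Longrightarrow> y \<in> V (Suc n) \<Longrightarrow> x \<otimes> y \<in> V n"
    by metis
  have VM: "V n \<subseteq> carrier M" for n using V(3) W(4) by blast
  have "\<exists>x P. x \<in> V (Suc n) \<and> openin X P \<and> \<one> \<in> P \<and> P \<subseteq> V (Suc n) \<and> (\<forall>u\<in>U. x \<otimes> u \<notin> P)" for n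
  proof -
    obtain x where x: "x \<in> V (Suc n)" "inv x \<notin> X closure_of U"
      using neg[of "V (Suc n)"] V VM W(3) by blast
    have xM: "x \<in> carrier M" using x VM by blast
    obtain T where T: "inv x \<in> T" "openin X T" "T \<inter> U = {}"
      using x(2) carrier_topspace[OF inv_closed[OF xM]] unfolding in_closure_of by blast
    \<comment> \<open>Since \<open>T\<close> is a neighbourhood of \<open>inv x\<close> that misses
      \<open>U\<close>, its translate by \<open>x\<close> is a neighbourhood of the unit that misses
      the translate of \<open>U\<close>.\<close>
    let ?P = "(\<lambda>u. x \<otimes> u) ` (T \<inter> carrier M) \<inter> V (Suc n)"
    have "openin X ?P"
      using open_translate[of "T \<inter> carrier M" x] T open_carrier xM V by auto
    moreover have "\<one> = x \<otimes> inv x" using xM by simp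
    then have "\<one> \<in> ?P" using T xM V(2) by blast
    moreover have "x \<otimes> u \<notin> ?P" if u: "u \<in> U" for u
    proof
      assume a: "x \<otimes> u \<in> ?P"
      then obtain t where t: "t \<in> T" "t \<in> carrier M" "x \<otimes> u = x \<otimes> t" by blast
      have "u = t" using t u U(3) xM by (simp add: subset_iff)
      then show False using t u T by blast
    qed
    ultimately show ?thesis using x(1) by blast
  qed
  then obtain x P where x: "\<And>n. x n \<in> V (Suc n)" and P: "\<And>n. openin X (P n)" "\<And>n. \<one> \<in> P n"
    "\<And>n. P n \<subseteq> V (Suc n)" and disj: "\<And>n u. u \<in> U \<Longrightarrow> x n \<otimes> u \<notin> P n"
    by metis
  define p where "p = rec_nat \<one> (\<lambda>n y. y \<otimes> x n)"
  have p0: "p 0 = \<one>" and pS: "p (Suc n) = p n \<otimes> x n" for n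
    by (simp_all add: p_def)
  have xM: "x n \<in> carrier M" for n using x VM by blast
  have pM: "p n \<in> carrier M" for n by (induction n) (simp_all add: p0 pS xM)
  define D where "D n = (\<lambda>u. p n \<otimes> u) ` V n" for n
  define Q where "Q n = (\<lambda>u. p n \<otimes> u) ` P n" for n
  have "D (Suc n) \<subseteq> D n" for n
  proof
    fix y assume "y \<in> D (Suc n)"
    then obtain v where v: "v \<in> V (Suc n)" "y = p n \<otimes> x n \<otimes> v"
      unfolding D_def pS by blast
    then have "y = p n \<otimes> (x n \<otimes> v)" using pM xM VM by (simp add: m_assoc subset_iff)
    then show "y \<in> D n" using VV[OF x v(1)] unfolding D_def by blast
  qed
  then have D_anti: "D n \<subseteq> D m" if "m \<le> n" for m n
    using that by (rule lift_Suc_antimono_le)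
  have "V (Suc n) \<subseteq> V n" for n
  proof
    fix v assume v: "v \<in> V (Suc n)"
    show "v \<in> V n" using VV[OF v V(2)] v VM by (simp add: subset_iff)
  qed
  then have QD: "Q n \<subseteq> D n" for n
    using P(3) unfolding Q_def D_def by blast
  have Qopen: "openin X (Q n)" for n
    unfolding Q_def using open_translate[OF P(1) _ pM] P(3)[of n] VM[of "Suc n"] by blast
  have Qne: "Q n \<noteq> {}" for n using P(2) unfolding Q_def by blast
  obtain q where q: "q \<in> topspace X" "\<And>T. openin X T \<Longrightarrow> q \<in> T \<Longrightarrow> infinite {n. Q n \<inter> T \<noteq> {}}"
    using pseudocompact_cluster_point[where Q = Q, OF pseudocompact Qopen Qne] by blast
  have qD: "q \<in> X closure_of D m" for m
    unfolding in_closure_of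
  proof (intro conjI allI impI q(1))
    fix T assume "q \<in> T \<and> openin X T"
    then have "infinite {n. Q n \<inter> T \<noteq> {}}" using q(2) by blast
    then obtain n where "n \<ge> m" "Q n \<inter> T \<noteq> {}"
      unfolding infinite_nat_iff_unbounded_le by blast
    then show "\<exists>y. y \<in> D m \<and> y \<in> T" using QD D_anti by blast
  qed
  have "D 0 \<subseteq> N" using V(3) W(3) VM by (auto simp: D_def p0 subset_iff)
  then have "q \<noteq> z"
    using qD[of 0] NZ unfolding in_closure_of by blast
  moreover have "D 0 \<subseteq> insert z (carrier M)" using \<open>D 0 \<subseteq> N\<close> NZ by blast
  then have "q \<in> insert z (carrier M)"
    using qD[of 0] closure_of_minimal[OF _ closed_carrier_zero] by blast
  ultimately have qM: "q \<in> carrier M" by blast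
  have "q = q \<otimes> \<one>" using qM by simp
  then have "q \<in> (\<lambda>u. q \<otimes> u) ` W" using W by blast
  then have "infinite {n. Q n \<inter> (\<lambda>u. q \<otimes> u) ` W \<noteq> {}}"
    using q(2) open_translate[OF W(1,4) qM] by blast
  then have "{n. Q n \<inter> (\<lambda>u. q \<otimes> u) ` W \<noteq> {}} \<noteq> {}" by (metis finite.emptyI)
  then obtain n w where w: "w \<in> W" "q \<otimes> w \<in> Q n" by blast
  have "w \<in> carrier M" using w W by blast
  then obtain A B where AB: "openin X A" "q \<in> A" "w \<in> B"
    "\<And>u v. u \<in> A \<Longrightarrow> v \<in> B \<Longrightarrow> u \<otimes> v \<in> Q n"
    using mult_nhds[OF Qopen w(2)] qM carrier_topspace by metis
  \<comment> \<open>The index is \<open>Suc n\<close> because \<open>x n\<close> first enters in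
    \<open>p (Suc n)\<close>: replacing \<open>q\<close> by a nearby
    \<open>p (Suc n) \<otimes> v\<close> exhibits a point of \<open>Q n\<close> as
    \<open>p n \<otimes> (x n \<otimes> (v \<otimes> w))\<close>.\<close>
  then obtain d where "d \<in> A" "d \<in> D (Suc n)"
    using qD[of "Suc n"] unfolding in_closure_of by blast
  then obtain v where v: "v \<in> V (Suc n)" "p (Suc n) \<otimes> v \<otimes> w \<in> Q n"
    using AB unfolding D_def by blast
  then obtain t where t: "t \<in> P n" "p (Suc n) \<otimes> v \<otimes> w = p n \<otimes> t"
    unfolding Q_def by blast
  have "v \<in> carrier M" "t \<in> carrier M" using v t P VM by blast+
  then have "p (Suc n) \<otimes> v \<otimes> w = p n \<otimes> (x n \<otimes> (v \<otimes> w))"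
    unfolding pS using pM xM \<open>w \<in> carrier M\<close> by (simp add: m_assoc)
  then have "t = x n \<otimes> (v \<otimes> w)"
    using t(2) pM[of n] xM[of n] \<open>w \<in> carrier M\<close> \<open>v \<in> carrier M\<close> \<open>t \<in> carrier M\<close> by simp
  moreover have "v \<otimes> w \<in> U" using W(5) v V(3) w by blast
  ultimately show False using disj t by blast
qed

text \<open>If zero were adherent, pick \<open>h\<^sub>n\<close> near zero with \<open>h\<^sub>n h\<^sub>m\<inverse>\<close> near zero for \<open>m < n\<close>;
  at a cluster point of the sets \<open>h\<^sub>n\<inverse> V\<close> these quotients come close to the unit.\<close>

lemma closed_carrier: "closedin X (carrier M)"
proof -
  have "z \<notin> X closure_of (carrier M)"
  proof
    assume adh: "z \<in> X closure_of (carrier M)"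
    obtain N Z where NZ: "openin X N" "\<one> \<in> N" "openin X Z" "z \<in> Z" "N \<inter> Z = {}" "N \<subseteq> carrier M"
      by (rule one_zero_separation)
    \<comment> \<open>Two halvings, because the final quotient is a product of four factors
      \<open>c\<close>, \<open>inv d\<close>, \<open>b\<close>, \<open>inv a\<close>: pairs land in
      the closure of \<open>N1\<close>, the whole in the closure of \<open>N\<close>, which misses
      \<open>Z\<close>.\<close>
    obtain N1 where N1: "openin X N1" "\<one> \<in> N1" "N1 \<subseteq> N" "\<And>x y. x \<in> N1 \<Longrightarrow> y \<in> N1 \<Longrightarrow> x \<otimes> y \<in> N"
      using square_root_nhd[OF NZ(1,2)] by metis
    obtain U where U: "openin X U" "\<one> \<in> U" "U \<subseteq> N1" "U \<subseteq> carrier M"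
      "\<And>x y. x \<in> U \<Longrightarrow> y \<in> U \<Longrightarrow> x \<otimes> y \<in> N1"
      using square_root_nhd[OF N1(1,2)] by metis
    obtain V where V: "openin X V" "\<one> \<in> V" "V \<subseteq> U" "\<And>v. v \<in> V \<Longrightarrow> inv v \<in> X closure_of U"
      using inverse_nhd[OF U(1,2,4)] by metis
    have VM: "V \<subseteq> carrier M" using V U by blast
    obtain A B where AB: "openin X A" "z \<in> A" "openin X B" "z \<in> B"
      "\<And>u v. u \<in> A \<Longrightarrow> v \<in> B \<Longrightarrow> u \<otimes> v \<in> Z"
      using mult_nhds[of Z z z] NZ zero_topspace zero_left by auto
    define O0 where "O0 = A \<inter> B"
    have O0: "openin X O0" "z \<in> O0" "\<And>u v. u \<in> O0 \<Longrightarrow> v \<in> O0 \<Longrightarrow> u \<otimes> v \<in> Z"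
      using AB by (auto simp: O0_def)
    \<comment> \<open>Right translation by \<open>inv k\<close> fixes zero, so each condition holds
      on a neighbourhood of zero. Finitely many of them leave a neighbourhood, which meets the group
      by adherence.\<close>
    have pick: "\<exists>h. h \<in> O0 \<inter> carrier M \<and> (\<forall>k\<in>F. h \<otimes> inv k \<in> Z)"
      if F: "finite F" "F \<subseteq> carrier M" for F
    proof -
      have "openin X {y \<in> topspace X. y \<otimes> inv k \<in> Z}" if "k \<in> F" for k
        using continuous_right_mult[of "inv k"] NZ(3) F(2) that carrier_topspace
        by (intro openin_continuous_map_preimage) auto
      then have "openin X (\<Inter>(insert O0 ((\<lambda>k. {y \<in> topspace X. y \<otimes> inv k \<in> Z}) ` F)))"
        using F(1) O0(1) by (intro openin_Inter) auto
      then have "openin X (O0 \<inter> \<Inter>((\<lambda>k. {y \<in> topspace X. y \<otimes> inv k \<in> Z}) ` F))"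
        by simp
      moreover have "z \<in> O0 \<inter> \<Inter>((\<lambda>k. {y \<in> topspace X. y \<otimes> inv k \<in> Z}) ` F)"
        using O0 NZ zero_topspace zero_left F by (auto simp: subset_iff)
      ultimately obtain h where "h \<in> carrier M" "h \<in> O0 \<inter> \<Inter>((\<lambda>k. {y \<in> topspace X. y \<otimes> inv k \<in> Z}) ` F)"
        using adh unfolding in_closure_of by meson
      then show ?thesis by blast
    qed
    have "\<exists>h :: nat \<Rightarrow> 'a. \<forall>n. h n \<in> O0 \<inter> carrier M \<and> (\<forall>m<n. h n \<otimes> inv (h m) \<in> Z)"
    proof (rule dependent_wellorder_choice)
      fix f :: "nat \<Rightarrow> 'a" and n
      assume "\<And>m. m < n \<Longrightarrow> f m \<in> O0 \<inter> carrier M \<and> (\<forall>k<m. f m \<otimes> inv (f k) \<in> Z)"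
      then have "f ` {..<n} \<subseteq> carrier M" by auto
      then show "\<exists>r. r \<in> O0 \<inter> carrier M \<and> (\<forall>m<n. r \<otimes> inv (f m) \<in> Z)"
        using pick[of "f ` {..<n}"] by auto
    qed auto
    then obtain h :: "nat \<Rightarrow> 'a" where "\<forall>n. h n \<in> O0 \<inter> carrier M \<and> (\<forall>m<n. h n \<otimes> inv (h m) \<in> Z)" ..
    then have h: "\<And>n. h n \<in> O0" "\<And>n. h n \<in> carrier M"
      "\<And>m n. m < n \<Longrightarrow> h n \<otimes> inv (h m) \<in> Z"
      by simp_all
    define Q where "Q n = (\<lambda>u. inv (h n) \<otimes> u) ` V" for n
    have Qopen: "openin X (Q n)" for n
      unfolding Q_def using open_translate V(1) VM h(2) by simp
    have QM: "Q n \<subseteq> carrier M" for n using h VM by (auto simp: Q_def subset_iff)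
    have Qne: "Q n \<noteq> {}" for n using V(2) unfolding Q_def by blast
    obtain q where q: "q \<in> topspace X" "\<And>T. openin X T \<Longrightarrow> q \<in> T \<Longrightarrow> infinite {n. Q n \<inter> T \<noteq> {}}"
      using pseudocompact_cluster_point[where Q = Q, OF pseudocompact Qopen Qne] by blast
    have ex: "\<exists>n. Q n \<inter> T \<noteq> {}" if "openin X T" "q \<in> T" for T
      using q(2)[OF that] not_finite_existsD by auto
    \<comment> \<open>Multiplying a common point by \<open>h n\<close>, itself in \<open>O0\<close>,
      would give an element of \<open>V\<close> lying in \<open>Z\<close>. Hence zero is no cluster
      point of the \<open>Q n\<close>.\<close>
    have "Q n \<inter> O0 = {}" for n
    proof -
      have "inv (h n) \<otimes> v \<notin> O0" if v: "v \<in> V" for v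
      proof
        assume "inv (h n) \<otimes> v \<in> O0"
        then have "h n \<otimes> (inv (h n) \<otimes> v) \<in> Z" using O0 h by blast
        moreover have "h n \<otimes> (inv (h n) \<otimes> v) = v"
          using h VM v by (simp add: m_assoc[symmetric] subset_iff)
        ultimately have "v \<in> Z" by simp
        moreover have "v \<in> N" using v V(3) U(3) N1(3) by blast
        ultimately show False using NZ(5) by blast
      qed
      then show ?thesis by (auto simp: Q_def)
    qed
    then have "q \<noteq> z" using ex[OF O0(1)] O0(2) by blast
    moreover have "q \<in> insert z (carrier M)"
    proof (rule ccontr)
      assume "\<not> ?thesis"
      then have "q \<in> topspace X - insert z (carrier M)" using q(1) by blast
      then show False
        using ex[of "topspace X - insert z (carrier M)"] closed_carrier_zero QM by blast
    qed
    ultimately have qM: "q \<in> carrier M" by blast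
    have "q = q \<otimes> \<one>" using qM by simp
    then have "q \<in> (\<lambda>u. q \<otimes> u) ` V" using V by blast
    then have inf: "infinite {n. Q n \<inter> (\<lambda>u. q \<otimes> u) ` V \<noteq> {}}"
      using q(2) open_translate[OF V(1) VM qM] by blast
    then obtain m where m: "Q m \<inter> (\<lambda>u. q \<otimes> u) ` V \<noteq> {}"
      using not_finite_existsD by blast
    obtain n where n: "n > m" "Q n \<inter> (\<lambda>u. q \<otimes> u) ` V \<noteq> {}"
      using inf unfolding infinite_nat_iff_unbounded by blast
    obtain a b where ab: "a \<in> V" "b \<in> V" "inv (h m) \<otimes> a = q \<otimes> b"
      using m unfolding Q_def by blast
    obtain c d where cd: "c \<in> V" "d \<in> V" "inv (h n) \<otimes> c = q \<otimes> d"
      using n unfolding Q_def by blast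
    have M: "a \<in> carrier M" "b \<in> carrier M" "c \<in> carrier M" "d \<in> carrier M"
      using ab cd VM by blast+
    \<comment> \<open>Both \<open>Q m\<close> and \<open>Q n\<close> meet the translate of
      \<open>V\<close> by \<open>q\<close>. Solving for \<open>inv (h m)\<close> and
      \<open>h n\<close> puts \<open>q\<close> at the left end of one and \<open>inv q\<close> at
      the right end of the other, so they cancel in the quotient.\<close>
    have "inv (h m) = q \<otimes> b \<otimes> inv a"
      using ab(3) M qM h(2)[of m] by (metis inv_closed inv_solve_right m_closed)
    moreover have "h n = c \<otimes> inv d \<otimes> inv q"
    proof -
      have "h n \<otimes> (q \<otimes> d) = c"
        using cd(3) M h(2)[of n] qM by (metis inv_closed inv_solve_left m_closed)
      then show ?thesis
        using M h(2)[of n] qM by (metis inv_closed inv_mult_group inv_solve_right m_assoc m_closed)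
    qed
    ultimately have "h n \<otimes> inv (h m) = c \<otimes> inv d \<otimes> inv q \<otimes> (q \<otimes> b \<otimes> inv a)" by simp
    also have "\<dots> = c \<otimes> inv d \<otimes> (inv q \<otimes> q) \<otimes> b \<otimes> inv a"
      using M qM by (simp only: m_assoc m_closed inv_closed)
    also have "\<dots> = c \<otimes> inv d \<otimes> b \<otimes> inv a"
      using M qM by simp
    also have "\<dots> = (c \<otimes> inv d) \<otimes> (b \<otimes> inv a)"
      using M qM by (simp add: m_assoc)
    finally have eq: "h n \<otimes> inv (h m) = (c \<otimes> inv d) \<otimes> (b \<otimes> inv a)" .
    have clU: "v \<in> X closure_of U" if "v \<in> V" for v
      using that V(3) closure_of_subset[OF openin_subset[OF U(1)]] by blast
    have quotient: "s \<otimes> inv t \<in> X closure_of N1" if "s \<in> V" "t \<in> V" for s t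
      by (rule closure_of_mult[OF clU[OF that(1)] V(4)[OF that(2)] U(5)])
    have "h n \<otimes> inv (h m) \<in> X closure_of N"
      unfolding eq using ab cd by (intro closure_of_mult[OF quotient quotient N1(4)])
    then show False
      using h(3)[OF n(1)] NZ unfolding in_closure_of by blast
  qed
  moreover have "X closure_of (carrier M) \<subseteq> insert z (carrier M)"
    by (rule closure_of_minimal[OF subset_insertI closed_carrier_zero])
  ultimately have "X closure_of (carrier M) \<subseteq> carrier M" by blast
  then show ?thesis
    using closure_of_subset_eq openin_subset[OF open_carrier] by metis
qed

end

section \<open>Algebra of orthogonal sums of Brandt semigroups\<close>

lemma prim_mult_simps [simp]:
  "prim_mult G None y = None"
  "prim_mult G x None = None"
  "prim_mult G (Some (i, a, g, b)) (Some (j, c, h, d)) =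
     (if i = j \<and> b = c then Some (i, a, g \<otimes>\<^bsub>G i\<^esub> h, d) else None)"
  by (auto simp: prim_mult_def split: option.splits)

lemma prim_carrier_iff [simp]:
  "None \<in> prim_carrier I L G"
  "Some (i, a, g, b) \<in> prim_carrier I L G \<longleftrightarrow> i \<in> I \<and> a \<in> L i \<and> b \<in> L i \<and> g \<in> carrier (G i)"
  by (auto simp: prim_carrier_def)

lemma cell_iff [simp]:
  "None \<notin> cell G i a b"
  "Some (j, c, g, d) \<in> cell G i a b \<longleftrightarrow> j = i \<and> c = a \<and> d = b \<and> g \<in> carrier (G i)"
  by (auto simp: cell_def)

lemma pelt_cases [case_names None Some]:
  obtains "x = None" | i a g b where "x = Some (i, a, g, b)"
  by (cases x) (auto simp: split_paired_all)

lemma group_max_subgroup: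
  assumes "group (G i)"
  shows "group (max_subgroup G i a)"
proof -
  interpret group "G i" by fact
  show ?thesis
  proof (rule groupI)
    fix x assume "x \<in> carrier (max_subgroup G i a)"
    then obtain g where g: "g \<in> carrier (G i)" "x = Some (i, a, g, a)"
      by (auto simp: max_subgroup_def cell_def)
    then have "Some (i, a, inv\<^bsub>G i\<^esub> g, a) \<otimes>\<^bsub>max_subgroup G i a\<^esub> x = \<one>\<^bsub>max_subgroup G i a\<^esub>"
      by (simp add: max_subgroup_def)
    moreover have "Some (i, a, inv\<^bsub>G i\<^esub> g, a) \<in> carrier (max_subgroup G i a)"
      using g by (simp add: max_subgroup_def)
    ultimately show "\<exists>y\<in>carrier (max_subgroup G i a).
        y \<otimes>\<^bsub>max_subgroup G i a\<^esub> x = \<one>\<^bsub>max_subgroup G i a\<^esub>"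
      by blast
  qed (auto simp: max_subgroup_def cell_def m_assoc)
qed

section \<open>Cells of a pseudocompact primitive inverse semigroup\<close>

locale primitive_topology =
  fixes I :: "'i set" and L :: "'i \<Rightarrow> 'l set" and G :: "'i \<Rightarrow> 'g monoid"
    and X :: "('i, 'l, 'g) pelt topology"
  assumes groups: "i \<in> I \<Longrightarrow> group (G i)"
    and topspace_eq: "topspace X = prim_carrier I L G"
    and topological_semigroup: "topological_semigroup X (prim_mult G)"
    and pseudocompact: "pseudocompact_space X"
begin

sublocale continuous_mult X "prim_mult G"
  using topological_semigroup by unfold_locales (auto simp: topological_semigroup_def)

lemma one_closed [simp]: "i \<in> I \<Longrightarrow> \<one>\<^bsub>G i\<^esub> \<in> carrier (G i)"
  by (simp add: groups group.is_monoid monoid.one_closed)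

lemma continuous_two_sided:
  assumes "p \<in> topspace X" "q \<in> topspace X"
  shows "continuous_map X X (\<lambda>x. prim_mult G (prim_mult G p x) q)"
  using continuous_map_compose[OF continuous_left_mult[OF assms(1)] continuous_right_mult[OF assms(2)]]
  by (simp add: o_def)

text \<open>This map is the source of all topology of the cells: a cell is where it is non-zero,
  hence open, and the cell with zero is its set of fixed points, hence closed.\<close>

lemma two_sided_unit:
  assumes i: "i \<in> I" and x: "x \<in> topspace X"
  shows "prim_mult G (prim_mult G (Some (i, a, \<one>\<^bsub>G i\<^esub>, a)) x) (Some (i, b, \<one>\<^bsub>G i\<^esub>, b)) =
    (if x \<in> cell G i a b then x else None)"
proof -
  interpret group "G i" using groups i by blast
  show ?thesis using x by (cases x rule: pelt_cases) (auto simp: topspace_eq)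
qed

lemma openin_cell:
  assumes i: "i \<in> I" "a \<in> L i" "b \<in> L i"
  shows "openin X (cell G i a b)"
proof -
  let ?f = "\<lambda>x. prim_mult G (prim_mult G (Some (i, a, \<one>\<^bsub>G i\<^esub>, a)) x) (Some (i, b, \<one>\<^bsub>G i\<^esub>, b))"
  have "continuous_map X X ?f"
    using i by (intro continuous_two_sided) (auto simp: topspace_eq)
  moreover have "openin X (topspace X - {None})"
    by (intro openin_diff openin_topspace closedin_Hausdorff_singleton[OF Hausdorff])
      (simp add: topspace_eq)
  ultimately have "openin X {x \<in> topspace X. ?f x \<in> topspace X - {None}}"
    by (rule openin_continuous_map_preimage)
  moreover have "{x \<in> topspace X. ?f x \<in> topspace X - {None}} = cell G i a b"
  proof -
    have "cell G i a b \<subseteq> topspace X"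
      using i by (auto simp: cell_def topspace_eq)
    moreover have "?f x \<in> topspace X - {None} \<longleftrightarrow> x \<in> cell G i a b" if "x \<in> topspace X" for x
      unfolding two_sided_unit[OF i(1) that] using that cell_iff(1)[of G i a b]
      by (metis DiffD2 DiffI singletonD singletonI)
    ultimately show ?thesis by blast
  qed
  ultimately show ?thesis by simp
qed

lemma closedin_insert_zero_cell:
  assumes i: "i \<in> I" "a \<in> L i" "b \<in> L i"
  shows "closedin X (insert None (cell G i a b))"
proof -
  let ?f = "\<lambda>x. prim_mult G (prim_mult G (Some (i, a, \<one>\<^bsub>G i\<^esub>, a)) x) (Some (i, b, \<one>\<^bsub>G i\<^esub>, b))"
  have "continuous_map X X ?f"
    using i by (intro continuous_two_sided) (auto simp: topspace_eq)
  then have "closedin X {x \<in> topspace X. ?f x = x}"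
    using closedin_continuous_maps_eq[OF Hausdorff _ continuous_map_id] by auto
  moreover have "cell G i a b \<subseteq> topspace X" "None \<in> topspace X"
    using i by (auto simp: cell_def topspace_eq)
  then have "{x \<in> topspace X. ?f x = x} = insert None (cell G i a b)"
    using two_sided_unit[OF i(1), of _ a b] by (auto split: if_splits)
  ultimately show ?thesis by simp
qed

lemma closedin_max_subgroup:
  assumes i: "i \<in> I" "a \<in> L i"
  shows "closedin X (cell G i a a)"
proof -
  have "zero_extended_group (max_subgroup G i a) X None"
    unfolding zero_extended_group_def zero_extended_group_axioms_def
    using i group_max_subgroup[of G i a] groups[OF i(1)] continuous_mult_axioms pseudocompact
      openin_cell closedin_insert_zero_cell
    by (simp add: max_subgroup_def)
  from zero_extended_group.closed_carrier[OF this] show ?thesis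
    by (simp add: max_subgroup_def)
qed

text \<open>The group argument covers only diagonal cells. Right multiplication by
  \<open>Some (i, b, \<one>, a)\<close> moves column \<open>b\<close> to column \<open>a\<close>,
  and the cell is exactly the preimage of the diagonal one.\<close>

lemma closedin_cell:
  assumes i: "i \<in> I" "a \<in> L i" "b \<in> L i"
  shows "closedin X (cell G i a b)"
proof -
  interpret group "G i" using groups i by blast
  let ?f = "\<lambda>x. prim_mult G x (Some (i, b, \<one>\<^bsub>G i\<^esub>, a))"
  have "closedin X {x \<in> topspace X. ?f x \<in> cell G i a a}"
    using i by (intro closedin_continuous_map_preimage[OF continuous_right_mult] closedin_max_subgroup)
      (auto simp: topspace_eq)
  moreover have "{x \<in> topspace X. ?f x \<in> cell G i a a} = cell G i a b" (is "?A = ?B")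
  proof (rule Set.set_eqI)
    show "x \<in> ?A \<longleftrightarrow> x \<in> ?B" for x
      using i by (cases x rule: pelt_cases) (auto simp: topspace_eq)
  qed
  ultimately show ?thesis by simp
qed

lemma pseudocompact_max_subgroup:
  assumes "i \<in> I" "a \<in> L i"
  shows "pseudocompact_space (subtopology X (cell G i a a))"
  using pseudocompact_subspace[OF pseudocompact closedin_max_subgroup[OF assms], of None]
    openin_cell assms by simp

lemma pseudocompact_brandt_part:
  assumes i: "i \<in> I"
  shows "pseudocompact_space (subtopology X (brandt_part L G i))"
proof (rule pseudocompact_subspace[OF pseudocompact])
  have "brandt_part L G i - {None} = (\<Union>a\<in>L i. \<Union>b\<in>L i. cell G i a b)"
    by (auto simp: brandt_part_def cell_def)
  then show "openin X (brandt_part L G i - {None})"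
    using i by (auto intro!: openin_Union openin_cell)
  have "topspace X - brandt_part L G i = (\<Union>j\<in>I-{i}. \<Union>a\<in>L j. \<Union>b\<in>L j. cell G j a b)"
    using i by (auto simp: topspace_eq brandt_part_def cell_def prim_carrier_def)
  then have "openin X (topspace X - brandt_part L G i)"
    by (auto intro!: openin_Union openin_cell)
  moreover have "brandt_part L G i \<subseteq> topspace X"
    using i by (auto simp: topspace_eq brandt_part_def)
  ultimately show "closedin X (brandt_part L G i)"
    by (simp add: closedin_def)
qed

lemma paratopological_max_subgroup:
  assumes i: "i \<in> I" "a \<in> L i"
  shows "paratopological_group (subtopology X (cell G i a a)) (max_subgroup G i a)"
proof -
  have sub: "cell G i a a \<subseteq> topspace X"
    using openin_cell[of i a a] i openin_subset by blast
  have "(\<lambda>(x, y). prim_mult G x y) \<in> cell G i a a \<times> cell G i a a \<rightarrow> cell G i a a"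
    using group.is_monoid[OF groups[OF i(1)]] by (auto simp: cell_def monoid.m_closed)
  moreover have "topspace (subtopology (prod_topology X X) (cell G i a a \<times> cell G i a a)) \<subseteq>
      cell G i a a \<times> cell G i a a"
    by simp
  ultimately have "continuous_map (prod_topology (subtopology X (cell G i a a)) (subtopology X (cell G i a a)))
      (subtopology X (cell G i a a)) (\<lambda>(x, y). prim_mult G x y)"
    unfolding continuous_map_in_subtopology subtopology_Times[symmetric]
    using continuous_map_from_subtopology[OF continuous_mult] by blast
  then show ?thesis
    unfolding paratopological_group_def
    using group_max_subgroup[of G i a] groups[OF i(1)] sub Hausdorff Hausdorff_space_subtopology
    by (auto simp: max_subgroup_def)
qed

text \<open>Cells are disjoint and open, so only zero can be a cluster point of such a family.\<close>

lemma cells_cluster_at_zero: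
  assumes J: "infinite J"
    and Q: "\<And>i a b. (i, a, b) \<in> J \<Longrightarrow> i \<in> I \<and> a \<in> L i \<and> b \<in> L i \<and>
      openin X (Q (i, a, b)) \<and> Q (i, a, b) \<noteq> {} \<and> Q (i, a, b) \<subseteq> cell G i a b"
    and W: "openin X W" "None \<in> W"
  shows "\<exists>c\<in>J. Q c \<inter> W \<noteq> {}"
proof (rule ccontr)
  assume neg: "\<not> ?thesis"
  have disj: "(i, a, b) = (j, c, d)"
    if "(i, a, b) \<in> J" "(j, c, d) \<in> J" "x \<in> cell G i a b" "x \<in> Q (j, c, d)" for i a b j c d x
    using Q[OF that(2)] that(3,4) by (auto simp: cell_def)
  \<comment> \<open>Pseudocompactness bounds the number of sets, not of indices; non-empty subsets
    of disjoint cells are distinct.\<close>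
  have "inj_on Q J"
  proof (rule inj_onI)
    fix s t assume "s \<in> J" "t \<in> J" "Q s = Q t"
    moreover obtain i a b where s: "s = (i, a, b)" by (cases s)
    moreover obtain j c d where t: "t = (j, c, d)" by (cases t)
    moreover obtain x where "x \<in> Q s" "x \<in> cell G i a b"
      using Q \<open>s \<in> J\<close> s by blast
    ultimately show "s = t" using disj by blast
  qed
  then have inf: "infinite (Q ` J)" using J finite_imageD by blast
  have op: "\<forall>U\<in>Q ` J. openin X U \<and> U \<noteq> {}" using Q by auto
  have "locally_finite_in X (Q ` J)"
    unfolding locally_finite_in_def
  proof (intro conjI ballI)
    show "\<Union>(Q ` J) \<subseteq> topspace X" using op openin_subset by blast
  next
    fix x assume x: "x \<in> topspace X"
    show "\<exists>V. openin X V \<and> x \<in> V \<and> finite {U \<in> Q ` J. U \<inter> V \<noteq> {}}"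
    proof (cases x rule: pelt_cases)
      case None
      have "{U \<in> Q ` J. U \<inter> W \<noteq> {}} = {}" using neg by blast
      then have "finite {U \<in> Q ` J. U \<inter> W \<noteq> {}}" by (simp only: finite.emptyI)
      then show ?thesis using None W by blast
    next
      case (Some i a g b)
      have "{U \<in> Q ` J. U \<inter> cell G i a b \<noteq> {}} \<subseteq> {Q (i, a, b)}"
      proof
        fix U assume "U \<in> {U \<in> Q ` J. U \<inter> cell G i a b \<noteq> {}}"
        then obtain j c d y where y: "(j, c, d) \<in> J" "U = Q (j, c, d)" "y \<in> U" "y \<in> cell G i a b"
          by auto
        then have "(j, c, d) = (i, a, b)" using Q[OF y(1)] by (auto simp: cell_def)
        then show "U \<in> {Q (i, a, b)}" using y by simp
      qed
      then have "finite {U \<in> Q ` J. U \<inter> cell G i a b \<noteq> {}}"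
        using finite_subset by blast
      moreover have "openin X (cell G i a b)" "x \<in> cell G i a b"
        using x Some by (auto simp: topspace_eq intro: openin_cell)
      ultimately show ?thesis by blast
    qed
  qed
  then show False
    using pseudocompact op inf unfolding pseudocompact_space_def by blast
qed

section \<open>Finiteness of the index sets and neighbourhood bases\<close>

text \<open>Zero times zero is zero, so products from \<open>A\<close> and \<open>B\<close> stay
  away from the unit. Infinitely many cells of row \<open>a\<close> would have to meet
  \<open>A\<close>; fixing a point of \<open>A\<close> in each, the elements that multiply it close
  to the unit form open sets in column \<open>a\<close>, one of which must meet
  \<open>B\<close>.\<close>

lemma finite_index:
  assumes i: "i \<in> I" and a: "a \<in> L i"
  shows "finite (L i)"
proof (rule ccontr)
  assume infL: "infinite (L i)"
  interpret group "G i" using groups i by blast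
  let ?e = "Some (i, a, \<one>\<^bsub>G i\<^esub>, a)"
  have "?e \<in> topspace X" "None \<in> topspace X" using i a by (auto simp: topspace_eq)
  then obtain N Z where NZ: "openin X N" "openin X Z" "?e \<in> N" "None \<in> Z" "N \<inter> Z = {}"
    using Hausdorff unfolding Hausdorff_space_def disjnt_def by (metis option.distinct(1))
  obtain A B where AB: "openin X A" "None \<in> A" "openin X B" "None \<in> B"
    "\<And>u v. u \<in> A \<Longrightarrow> v \<in> B \<Longrightarrow> prim_mult G u v \<in> Z"
    using mult_nhds[of Z None None] NZ \<open>None \<in> topspace X\<close> by auto
  define K where "K = {b \<in> L i. A \<inter> cell G i a b \<noteq> {}}"
  have finK: "finite K"
  proof (rule ccontr)
    assume "infinite K"
    have "\<exists>g. g \<in> carrier (G i) \<and> Some (i, a, g, b) \<in> A" if "b \<in> K" for b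
      using that by (auto simp: K_def cell_def)
    then obtain g where g: "\<And>b. b \<in> K \<Longrightarrow> g b \<in> carrier (G i)"
      "\<And>b. b \<in> K \<Longrightarrow> Some (i, a, g b, b) \<in> A"
      by metis
    \<comment> \<open>Non-empty, as it contains the semigroup inverse of
      \<open>Some (i, a, g b, b)\<close>; the intersection with the diagonal cell confines it to the
      cell in row \<open>b\<close> and column \<open>a\<close>.\<close>
    define Q where "Q c = (case c of (j, b, c) \<Rightarrow>
      {y \<in> topspace X. prim_mult G (Some (i, a, g b, b)) y \<in> N \<inter> cell G i a a})" for c :: "'i \<times> 'l \<times> 'l"
    have "\<exists>c\<in>(\<lambda>b. (i, b, a)) ` K. Q c \<inter> B \<noteq> {}"
    proof (rule cells_cluster_at_zero[OF _ _ AB(3,4)])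
      show "infinite ((\<lambda>b. (i, b, a)) ` K)"
        using \<open>infinite K\<close> finite_imageD[of "\<lambda>b. (i, b, a)" K] by (auto simp: inj_on_def)
    next
      fix j b c assume "(j, b, c) \<in> (\<lambda>b. (i, b, a)) ` K"
      then have jbc: "j = i" "c = a" "b \<in> K" by auto
      have bL: "b \<in> L i" using jbc by (simp add: K_def)
      have "openin X (Q (j, b, c))"
        unfolding Q_def prod.case
        using i a bL g(1)[OF jbc(3)] NZ(1) openin_cell[OF i a a]
        by (intro openin_continuous_map_preimage[OF continuous_left_mult] openin_Int) (auto simp: topspace_eq)
      moreover have "Some (i, b, inv\<^bsub>G i\<^esub> (g b), a) \<in> Q (j, b, c)"
        using NZ(3) i a bL g(1)[OF jbc(3)] by (simp add: Q_def topspace_eq)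
      moreover have "y \<in> cell G i b a" if "y \<in> Q (j, b, c)" for y
        using that by (cases y rule: pelt_cases) (auto simp: Q_def topspace_eq split: if_splits)
      ultimately show "j \<in> I \<and> b \<in> L j \<and> c \<in> L j \<and> openin X (Q (j, b, c)) \<and>
          Q (j, b, c) \<noteq> {} \<and> Q (j, b, c) \<subseteq> cell G j b c"
        using jbc i a bL by auto
    qed
    then obtain b y where "b \<in> K" "y \<in> Q (i, b, a)" "y \<in> B" by blast
    then show False using AB(5)[OF g(2)] NZ(5) by (auto simp: Q_def)
  qed
  \<comment> \<open>The remaining cells of row \<open>a\<close> miss \<open>A\<close> entirely, so
    they can be used whole.\<close>
  define Q where "Q c = (case c of (j, b, d) \<Rightarrow> cell G j b d)" for c :: "'i \<times> 'l \<times> 'l"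
  have "\<exists>c\<in>(\<lambda>b. (i, a, b)) ` (L i - K). Q c \<inter> A \<noteq> {}"
  proof (rule cells_cluster_at_zero[OF _ _ AB(1,2)])
    show "infinite ((\<lambda>b. (i, a, b)) ` (L i - K))"
      using infL finK finite_imageD[of "\<lambda>b. (i, a, b)" "L i - K"] by (auto simp: inj_on_def)
  next
    fix j b c assume "(j, b, c) \<in> (\<lambda>b. (i, a, b)) ` (L i - K)"
    then show "j \<in> I \<and> b \<in> L j \<and> c \<in> L j \<and> openin X (Q (j, b, c)) \<and>
        Q (j, b, c) \<noteq> {} \<and> Q (j, b, c) \<subseteq> cell G j b c"
      using i a openin_cell by (auto simp: Q_def cell_def)
  qed
  then show False by (auto simp: Q_def K_def)
qed

text \<open>The two-sided translation \<open>f\<close> has a continuous inverse between the two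
  cells, namely the translation \<open>h\<close> by the semigroup inverses of its outer factors.
  Images under \<open>f\<close> are therefore preimages under \<open>h\<close>.\<close>

lemma nhds_base_translate:
  assumes i: "i \<in> I" "a \<in> L i" and b: "b \<in> L i" and c: "c \<in> L i" and x: "x \<in> carrier (G i)"
    and base: "nhds_base_at X (Some (i, a, \<one>\<^bsub>G i\<^esub>, a)) \<B>" and sub: "\<And>U. U \<in> \<B> \<Longrightarrow> U \<subseteq> cell G i a a"
  shows "nhds_base_at X (Some (i, b, x, c))
    ((\<lambda>U. (\<lambda>u. prim_mult G (prim_mult G (Some (i, b, x, a)) u) (Some (i, a, \<one>\<^bsub>G i\<^esub>, c))) ` U) ` \<B>)"
proof -
  interpret group "G i" using groups i by blast
  define f where "f u = prim_mult G (prim_mult G (Some (i, b, x, a)) u) (Some (i, a, \<one>\<^bsub>G i\<^esub>, c))" for u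
  define h where "h v = prim_mult G (prim_mult G (Some (i, a, inv\<^bsub>G i\<^esub> x, b)) v)
    (Some (i, c, \<one>\<^bsub>G i\<^esub>, a))" for v
  have cf: "continuous_map X X f" and ch: "continuous_map X X h"
    unfolding f_def h_def using i b c x by (auto intro!: continuous_two_sided simp: topspace_eq)
  have fe: "f (Some (i, a, \<one>\<^bsub>G i\<^esub>, a)) = Some (i, b, x, c)"
    using x by (simp add: f_def)
  have hf: "h (f u) = u" "f u \<in> topspace X" if u: "u \<in> cell G i a a" for u
    using u i b c x by (auto simp: cell_def f_def h_def topspace_eq m_assoc[symmetric])
  have fh: "f (h v) = v" if v: "v \<in> topspace X" "h v \<in> cell G i a a" for v
    using v x by (cases v rule: pelt_cases)
      (auto simp: f_def h_def topspace_eq m_assoc[symmetric] split: if_splits)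
  have "openin X (f ` U)" if U: "U \<in> \<B>" for U
  proof -
    have "f ` U = {v \<in> topspace X. h v \<in> U}" (is "?A = ?B")
    proof
      show "?A \<subseteq> ?B" using hf sub[OF U] by auto
      show "?B \<subseteq> ?A"
      proof
        fix v assume "v \<in> ?B"
        then have "v = f (h v)" "h v \<in> U" using fh sub[OF U] by auto
        then show "v \<in> ?A" by blast
      qed
    qed
    moreover have "openin X U" using base U unfolding nhds_base_at_def by blast
    ultimately show ?thesis using openin_continuous_map_preimage[OF ch] by simp
  qed
  moreover have "Some (i, b, x, c) \<in> f ` U" if "U \<in> \<B>" for U
    using base that fe unfolding nhds_base_at_def by (metis imageI)
  moreover have "\<exists>U\<in>\<B>. f ` U \<subseteq> W" if W: "openin X W" "Some (i, b, x, c) \<in> W" for W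
  proof -
    have "openin X {u \<in> topspace X. f u \<in> W}"
      using cf W(1) by (rule openin_continuous_map_preimage)
    moreover have "Some (i, a, \<one>\<^bsub>G i\<^esub>, a) \<in> {u \<in> topspace X. f u \<in> W}"
      using fe W i by (simp add: topspace_eq)
    ultimately obtain U where "U \<in> \<B>" "U \<subseteq> {u \<in> topspace X. f u \<in> W}"
      using base unfolding nhds_base_at_def by blast
    then show ?thesis by blast
  qed
  ultimately have "nhds_base_at X (Some (i, b, x, c)) ((\<lambda>U. f ` U) ` \<B>)"
    unfolding nhds_base_at_def by auto
  then show ?thesis unfolding f_def .
qed

text \<open>A cell contained in the closure of a regular open set is contained in the set itself, so
  if infinitely many cells were not contained in a regular open neighbourhood of zero, their
  differences with its closure would violate pseudocompactness.\<close>

lemma nhds_base_zero: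
  assumes sr: "semiregular_space X"
  shows "nhds_base_at X None
    {topspace X - \<Union>\<F> | \<F>. finite \<F> \<and> \<F> \<subseteq> {cell G i a b | i a b. i \<in> I \<and> a \<in> L i \<and> b \<in> L i}}"
  unfolding nhds_base_at_def
proof (intro conjI ballI allI impI)
  fix U assume "U \<in> {topspace X - \<Union>\<F> | \<F>. finite \<F> \<and>
    \<F> \<subseteq> {cell G i a b | i a b. i \<in> I \<and> a \<in> L i \<and> b \<in> L i}}"
  then obtain \<F> where F: "U = topspace X - \<Union>\<F>" "finite \<F>"
    "\<F> \<subseteq> {cell G i a b | i a b. i \<in> I \<and> a \<in> L i \<and> b \<in> L i}"
    by blast
  \<comment> \<open>Here it matters that zero is adherent to no cell, off-diagonal ones
    included.\<close>
  have "closedin X C" if "C \<in> \<F>" for C using F(3) that closedin_cell by blast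
  then have "closedin X (\<Union>\<F>)" using F(2) by (intro closedin_Union) auto
  then show "openin X U" using F(1) by blast
  show "None \<in> U" using F(3) unfolding F(1) topspace_eq by auto
next
  fix W assume "openin X W \<and> None \<in> W"
  then obtain U where U: "regular_openin X U" "None \<in> U" "U \<subseteq> W"
    using sr unfolding semiregular_space_def by blast
  have Uopen: "openin X U"
    using U(1) openin_interior_of unfolding regular_openin_def by metis
  define J where "J = {(i, a, b). i \<in> I \<and> a \<in> L i \<and> b \<in> L i \<and> \<not> cell G i a b \<subseteq> U}"
  define Q where "Q c = (case c of (i, a, b) \<Rightarrow> cell G i a b - X closure_of U)" for c
  have "finite J"
  proof (rule ccontr)
    assume "infinite J"
    then have "\<exists>c\<in>J. Q c \<inter> U \<noteq> {}"
    proof (rule cells_cluster_at_zero[OF _ _ Uopen U(2)])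
      fix i a b assume "(i, a, b) \<in> J"
      then have J: "i \<in> I" "a \<in> L i" "b \<in> L i" "\<not> cell G i a b \<subseteq> U" by (auto simp: J_def)
      have "openin X (Q (i, a, b))"
        using openin_cell[OF J(1-3)] by (auto simp: Q_def)
      moreover have "\<not> cell G i a b \<subseteq> X closure_of U"
        using interior_of_maximal[OF _ openin_cell[OF J(1-3)], of "X closure_of U"] J(4) U(1)
        unfolding regular_openin_def by blast
      then have "Q (i, a, b) \<noteq> {}" by (auto simp: Q_def)
      ultimately show "i \<in> I \<and> a \<in> L i \<and> b \<in> L i \<and> openin X (Q (i, a, b)) \<and>
          Q (i, a, b) \<noteq> {} \<and> Q (i, a, b) \<subseteq> cell G i a b"
        using J by (auto simp: Q_def)
    qed
    then show False
      using closure_of_subset[OF openin_subset[OF Uopen]] by (auto simp: Q_def)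
  qed
  \<comment> \<open>A cell indexed outside \<open>J\<close> lies inside \<open>U\<close>, so
    removing the cells of \<open>J\<close> is enough.\<close>
  let ?F = "(\<lambda>(i, a, b). cell G i a b) ` J"
  have "topspace X - \<Union>?F \<subseteq> U"
  proof
    fix x assume x: "x \<in> topspace X - \<Union>?F"
    show "x \<in> U"
    proof (cases x rule: pelt_cases)
      case None
      then show ?thesis using U by simp
    next
      case (Some i a g b)
      then have "i \<in> I" "a \<in> L i" "b \<in> L i" "x \<in> cell G i a b"
        using x by (auto simp: topspace_eq)
      then show ?thesis using x unfolding J_def by blast
    qed
  qed
  moreover have "finite ?F \<and> ?F \<subseteq> {cell G i a b | i a b. i \<in> I \<and> a \<in> L i \<and> b \<in> L i}"
    using \<open>finite J\<close> by (auto simp: J_def)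
  ultimately show "\<exists>U\<in>{topspace X - \<Union>\<F> | \<F>. finite \<F> \<and>
      \<F> \<subseteq> {cell G i a b | i a b. i \<in> I \<and> a \<in> L i \<and> b \<in> L i}}. U \<subseteq> W"
    using U(3) by (metis (mono_tags, lifting) mem_Collect_eq subset_trans)
qed

end

theorem theorem3p5:
  fixes I :: "'i set" and L :: "'i \<Rightarrow> 'l set" and G :: "'i \<Rightarrow> 'g monoid"
    and X :: "('i, 'l, 'g) pelt topology"
  assumes groups: "\<forall>i\<in>I. group (G i)"
    and card_pos: "\<forall>i\<in>I. L i \<noteq> {}"
    and carrier: "topspace X = prim_carrier I L G"
    and topsg: "topological_semigroup X (prim_mult G)"
    and pc: "pseudocompact_space X"
  shows "(\<forall>i\<in>I. finite (L i)) \<and>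
    (\<forall>i\<in>I. \<forall>a\<in>L i. openin X (cell G i a a) \<and> closedin X (cell G i a a) \<and>
           pseudocompact_space (subtopology X (cell G i a a))) \<and>
    (\<forall>i\<in>I. pseudocompact_space (subtopology X (brandt_part L G i)) \<and>
           (\<forall>a\<in>L i. pseudocompact_space (subtopology X (cell G i a a)) \<and>
                     paratopological_group (subtopology X (cell G i a a)) (max_subgroup G i a))) \<and>
    (\<forall>i\<in>I. \<forall>a\<in>L i. \<forall>\<B>.
           nhds_base_at X (Some (i, a, \<one>\<^bsub>G i\<^esub>, a)) \<B> \<and> (\<forall>U\<in>\<B>. U \<subseteq> cell G i a a) \<longrightarrow>
           (\<forall>b\<in>L i. \<forall>c\<in>L i. \<forall>x\<in>carrier (G i).
              nhds_base_at X (Some (i, b, x, c))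
                ((\<lambda>U. (\<lambda>u. prim_mult G (prim_mult G (Some (i, b, x, a)) u)
                                          (Some (i, a, \<one>\<^bsub>G i\<^esub>, c))) ` U) ` \<B>))) \<and>
    (semiregular_space X \<longrightarrow>
           nhds_base_at X None
             {topspace X - \<Union>\<F> | \<F>. finite \<F> \<and>
                \<F> \<subseteq> {cell G i a b | i a b. i \<in> I \<and> a \<in> L i \<and> b \<in> L i}})"
proof -
  interpret primitive_topology I L G X
    using groups carrier topsg pc by (simp add: primitive_topology_def)
  have "finite (L i)" if "i \<in> I" for i
    using finite_index card_pos that by blast
  then show ?thesis
    using openin_cell closedin_max_subgroup pseudocompact_max_subgroup pseudocompact_brandt_part
      paratopological_max_subgroup
    by (intro conjI ballI allI impI nhds_base_translate nhds_base_zero) auto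
qed

end
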